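(* Let $k\ge 1$ and $n\ge 1$. Let $\tau$ be a $(k+1)$-ary increasing tree of order $n$ and let $\sigma=\Phi(\tau)$ be the $k$-Stirling permutation of order $n$ associated to it by the bijection $\Phi$ described in the context. Then \begin{align*} X_{n,j}(\sigma)&=D_{n,j+1}(\tau), && 1\le j\le k,\\ Y_{n,j}(\sigma)&=D_{n,j}(\tau), && 1\le j\le k,\\ Z_{n,j}(\sigma)&=L_{n,j+1}(\tau)=n-D_{n,j+1}(\tau), && 1\le j\le k-1, \end{align*} and consequently \[ X_n(\sigma)=n-D_{n,1}(\tau)=L_{n,1}(\tau),\qquad Y_n(\sigma)=n-D_{n,k+1}(\tau)=L_{n,k+1}(\tau),\qquad Z_n(\sigma)=\sum_{j=2}^{k}L_{n,j}(\tau). \] Furthermore, the number of blocks of $\sigma$ equals the number of left-right nodes of $\tau$: $S_n(\sigma)=LR_n(\tau)$.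
   Context: A $k$-Stirling permutation of order $n$ is a word $\sigma=a_1a_2\cdots a_{kn}$ in which each of $1,\dots,n$ occurs exactly $k$ times, such that for each $i$ every entry occurring between two occurrences of $i$ is at least $i$. Set $a_0=a_{kn+1}=0$. An index $i\in\{0,\dots,kn\}$ is an ascent if $a_i<a_{i+1}$, a descent if $a_i>a_{i+1}$, and a plateau if $a_i=a_{i+1}$; $X_n,Y_n,Z_n$ denote the total numbers of ascents, descents and plateaux. For $1\le i\le kn$: $i$ is a $j$-ascent if it is an ascent and $a_i$ is the $j$-th occurrence (from the left) of its value; $i$ is a $j$-plateau if it is a plateau and $a_i$ is the $j$-th occurrence of its value; and $i$ is a $j$-descent if $i<kn$, $i$ is a descent, and $a_{i+1}$ is the $j$-th occurrence of its value. $X_{n,j},Y_{n,j},Z_{n,j}$ denote the numbers of $j$-ascents, $j$-descents, $j$-plateaux. A block of $\sigma$ is a substring $a_p\cdots a_q$ ($p\le q$) with $a_p=a_q$ which is not contained in any strictly larger substring $a_{p'}\cdots a_{q'}$ with $a_{p'}=a_{q'}$; $S_n$ is the number of blocks. A $(k+1)$-ary increasing tree of order $n$ is a rooted tree with vertex set $\{1,\dots,n\}$, root $1$, labels increasing along every path away from the root, in which every vertex has $k+1$ positions numbered $1,\dots,k+1$ from left to right, each position being either empty or occupied by exactly one child, and each non-root vertex occupies exactly one position of its parent. $D_{n,j}(\tau)$ is the number of vertices occupying position $j$ of their parent; $L_{n,j}(\tau)$ is the number of pairs (vertex $v$, position $j$ of $v$) with that position empty. A left-right node is a vertex $v$ such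 that every non-root vertex on the path from the root to $v$ (including $v$) occupies position $1$ or position $k+1$ of its parent; the root is a left-right node. $LR_n(\tau)$ is the number of left-right nodes. The bijection $\Phi$: define $\mathrm{code}$ recursively by $\mathrm{code}(\emptyset)=$ empty word, and for a tree with root label $v$ and (possibly empty) subtrees $S_1,\dots,S_{k+1}$ in positions $1,\dots,k+1$, $\mathrm{code}=\mathrm{code}(S_1)\,v\,\mathrm{code}(S_2)\,v\cdots v\,\mathrm{code}(S_{k+1})$ (the $k$ copies of $v$ separating the $k+1$ codes). $\Phi(\tau)=\mathrm{code}(\tau)$; this is a bijection from $(k+1)$-ary increasing trees of order $n$ onto $k$-Stirling permutations of order $n$. *)

theory Defs
  imports Main
begin

section \<open>Trees with numbered child positions\<close>

text \<open>
  In \<open>Node v ts\<close> the list \<open>ts\<close> holds the subtrees in positions \<open>1, ..., length ts\<close> from left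
  to right, and \<open>Empty\<close> marks an empty position.  In the trees considered below the labels are
  pairwise distinct, so a vertex is identified with its label.
\<close>

datatype ptree = Empty | Node nat "ptree list"

primrec labels :: "ptree \<Rightarrow> nat list" where
  "labels Empty = []"
| "labels (Node v ts) = v # concat (map labels ts)"

definition vertices :: "ptree \<Rightarrow> nat set" where
  "vertices t = set (labels t)"

primrec subtrees :: "ptree \<Rightarrow> ptree set" where
  "subtrees Empty = {}"
| "subtrees (Node v ts) = insert (Node v ts) (\<Union> (set (map subtrees ts)))"

text \<open>\<open>child_at t u j v\<close>: in \<open>t\<close>, vertex \<open>v\<close> occupies position \<open>j\<close> (counted from 1) of \<open>u\<close>.\<close>

definition child_at :: "ptree \<Rightarrow> nat \<Rightarrow> nat \<Rightarrow> nat \<Rightarrow> bool" where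
  "child_at t u j v \<longleftrightarrow>
     (\<exists>ts us. Node u ts \<in> subtrees t \<and> 1 \<le> j \<and> j \<le> length ts \<and> ts ! (j - 1) = Node v us)"

definition empty_at :: "ptree \<Rightarrow> nat \<Rightarrow> nat \<Rightarrow> bool" where
  "empty_at t u j \<longleftrightarrow>
     (\<exists>ts. Node u ts \<in> subtrees t \<and> 1 \<le> j \<and> j \<le> length ts \<and> ts ! (j - 1) = Empty)"

text \<open>\<open>increasing_tree k n t\<close>: \<open>t\<close> is a \<open>(k+1)\<close>-ary increasing tree of order \<open>n\<close>.  Labels
  increase along every path away from the root iff they increase along every edge.\<close>

definition increasing_tree :: "nat \<Rightarrow> nat \<Rightarrow> ptree \<Rightarrow> bool" where
  "increasing_tree k n t \<longleftrightarrow>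
     (\<exists>ts. t = Node 1 ts) \<and>
     vertices t = {1..n} \<and> distinct (labels t) \<and>
     (\<forall>u ts. Node u ts \<in> subtrees t \<longrightarrow> length ts = k + 1) \<and>
     (\<forall>u j v. child_at t u j v \<longrightarrow> u < v)"

definition D :: "ptree \<Rightarrow> nat \<Rightarrow> nat" where
  "D t j = card {v \<in> vertices t. \<exists>u. child_at t u j v}"

definition L :: "ptree \<Rightarrow> nat \<Rightarrow> nat" where
  "L t j = card {v \<in> vertices t. empty_at t v j}"

definition edges :: "ptree \<Rightarrow> (nat \<times> nat) set" where
  "edges t = {(u, v). \<exists>j. child_at t u j v}"

text \<open>The vertices on the path from the root to \<open>v\<close> are the \<open>w\<close> with \<open>(w, v) \<in> (edges t)\<^sup>*\<close>;
  the root has label 1.\<close>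

definition left_right_node :: "nat \<Rightarrow> ptree \<Rightarrow> nat \<Rightarrow> bool" where
  "left_right_node k t v \<longleftrightarrow>
     v \<in> vertices t \<and>
     (\<forall>w. (w, v) \<in> (edges t)\<^sup>* \<and> w \<noteq> 1 \<longrightarrow> (\<exists>u. child_at t u 1 w \<or> child_at t u (k + 1) w))"

definition LR :: "nat \<Rightarrow> ptree \<Rightarrow> nat" where
  "LR k t = card {v. left_right_node k t v}"


section \<open>Statistics on words\<close>

text \<open>The entries \<open>a\<^sub>1, ..., a\<^sub>m\<close> of a word of length \<open>m\<close>, extended by \<open>a\<^sub>0 = a\<^sub>m\<^sub>+\<^sub>1 = 0\<close>; only
  indices up to \<open>m + 1\<close> are ever used.  For a \<open>k\<close>-Stirling permutation of order \<open>n\<close>,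
  \<open>m = k * n\<close>.\<close>

definition entry :: "nat list \<Rightarrow> nat \<Rightarrow> nat" where
  "entry w i = (0 # w @ [0]) ! i"

definition stirling_perm :: "nat \<Rightarrow> nat \<Rightarrow> nat list \<Rightarrow> bool" where
  "stirling_perm k n w \<longleftrightarrow>
     set w \<subseteq> {1..n} \<and> (\<forall>i\<in>{1..n}. count_list w i = k) \<and>
     (\<forall>p q r. 1 \<le> p \<and> p < r \<and> r < q \<and> q \<le> length w \<and> entry w p = entry w q
        \<longrightarrow> entry w p \<le> entry w r)"

definition ascent :: "nat list \<Rightarrow> nat \<Rightarrow> bool" where
  "ascent w i \<longleftrightarrow> i \<le> length w \<and> entry w i < entry w (i + 1)"

definition descent :: "nat list \<Rightarrow> nat \<Rightarrow> bool" where
  "descent w i \<longleftrightarrow> i \<le> length w \<and> entry w i > entry w (i + 1)"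

definition plateau :: "nat list \<Rightarrow> nat \<Rightarrow> bool" where
  "plateau w i \<longleftrightarrow> i \<le> length w \<and> entry w i = entry w (i + 1)"

definition X :: "nat list \<Rightarrow> nat" where
  "X w = card {i. ascent w i}"

definition Y :: "nat list \<Rightarrow> nat" where
  "Y w = card {i. descent w i}"

definition Z :: "nat list \<Rightarrow> nat" where
  "Z w = card {i. plateau w i}"

text \<open>\<open>occ w i = j\<close> iff \<open>a\<^sub>i\<close> is the \<open>j\<close>-th occurrence, from the left, of its value in \<open>w\<close>.\<close>

definition occ :: "nat list \<Rightarrow> nat \<Rightarrow> nat" where
  "occ w i = card {p \<in> {1..i}. entry w p = entry w i}"

definition Xj :: "nat list \<Rightarrow> nat \<Rightarrow> nat" where
  "Xj w j = card {i. 1 \<le> i \<and> i \<le> length w \<and> ascent w i \<and> occ w i = j}"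

definition Yj :: "nat list \<Rightarrow> nat \<Rightarrow> nat" where
  "Yj w j = card {i. 1 \<le> i \<and> i < length w \<and> descent w i \<and> occ w (i + 1) = j}"

definition Zj :: "nat list \<Rightarrow> nat \<Rightarrow> nat" where
  "Zj w j = card {i. 1 \<le> i \<and> i \<le> length w \<and> plateau w i \<and> occ w i = j}"

definition matched :: "nat list \<Rightarrow> nat \<Rightarrow> nat \<Rightarrow> bool" where
  "matched w p q \<longleftrightarrow> 1 \<le> p \<and> p \<le> q \<and> q \<le> length w \<and> entry w p = entry w q"

text \<open>Blocks are substrings at given places, hence pairs \<open>(p, q)\<close> of end indices.\<close>

definition block :: "nat list \<Rightarrow> nat \<Rightarrow> nat \<Rightarrow> bool" where
  "block w p q \<longleftrightarrow>
     matched w p q \<and>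
     \<not> (\<exists>p' q'. matched w p' q' \<and> p' \<le> p \<and> q \<le> q' \<and> (p', q') \<noteq> (p, q))"

definition S :: "nat list \<Rightarrow> nat" where
  "S w = card {(p, q). block w p q}"


section \<open>The bijection\<close>

fun join :: "'a \<Rightarrow> 'a list list \<Rightarrow> 'a list" where
  "join v [] = []"
| "join v [xs] = xs"
| "join v (xs # ys # zss) = xs @ v # join v (ys # zss)"

primrec code :: "ptree \<Rightarrow> nat list" where
  "code Empty = []"
| "code (Node v ts) = join v (map code ts)"


subsection \<open>Codes of increasing trees are Stirling permutations\<close>

definition nested :: "nat list \<Rightarrow> bool" where
  "nested w \<longleftrightarrow>
     (\<forall>p r q. p < r \<and> r < q \<and> q < length w \<and> w ! p = w ! q \<longrightarrow> w ! p \<le> w ! r)"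

lemma nested_append:
  assumes "nested xs" "nested ys" "set xs \<inter> set ys \<subseteq> {v}" "\<forall>x \<in> set xs \<union> set ys. v \<le> x"
  shows "nested (xs @ ys)"
  unfolding nested_def
proof (intro allI impI)
  fix p r q
  assume h: "p < r \<and> r < q \<and> q < length (xs @ ys) \<and> (xs @ ys) ! p = (xs @ ys) ! q"
  have r: "(xs @ ys) ! r \<in> set xs \<union> set ys"
    using h by (metis nth_mem order.strict_trans set_append)
  consider "q < length xs" | "length xs \<le> p" | "p < length xs" "length xs \<le> q"
    by linarith
  then show "(xs @ ys) ! p \<le> (xs @ ys) ! r"
  proof cases
    case 1
    then show ?thesis using h assms(1) by (auto simp: nested_def nth_append)
  next
    case 2
    have "(p - length xs) < (r - length xs)" "(r - length xs) < (q - length xs)"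
      "(q - length xs) < length ys"
      using 2 h by auto
    moreover have "ys ! (p - length xs) = ys ! (q - length xs)"
      using 2 h by (simp add: nth_append)
    ultimately have "ys ! (p - length xs) \<le> ys ! (r - length xs)"
      using assms(2) unfolding nested_def by blast
    then show ?thesis using 2 h by (simp add: nth_append)
  next
    case 3
    have "(xs @ ys) ! p \<in> set xs" using 3 by (simp add: nth_append)
    moreover have "(xs @ ys) ! q \<in> set ys" using 3 h by (auto simp: nth_append intro!: nth_mem)
    ultimately have "(xs @ ys) ! p = v" using h assms(3) by auto
    then show ?thesis using r assms(4) by auto
  qed
qed

lemma set_join: "set (join v xss) \<subseteq> insert v (\<Union> (set (map set xss)))"
  by (induction v xss rule: join.induct) auto

lemma nested_join:
  assumes "\<forall>xs \<in> set xss. nested xs \<and> (\<forall>x \<in> set xs. v < x)"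
    and "\<forall>i j. i < j \<and> j < length xss \<longrightarrow> set (xss ! i) \<inter> set (xss ! j) = {}"
  shows "nested (join v xss)"
  using assms
proof (induction v xss rule: join.induct)
  case (1 v)
  show ?case by (simp add: nested_def)
next
  case (2 v xs)
  show ?case using 2(1) by simp
next
  case (3 v xs ys zss)
  have disj: "set xs \<inter> set us = {}" if us: "us \<in> set (ys # zss)" for us
  proof -
    obtain j where j: "j < length (ys # zss)" "(ys # zss) ! j = us"
      using us unfolding in_set_conv_nth by blast
    then have "0 < Suc j \<and> Suc j < length (xs # ys # zss)" by simp
    then have "set ((xs # ys # zss) ! 0) \<inter> set ((xs # ys # zss) ! Suc j) = {}"
      by (rule 3(3)[rule_format])
    then show ?thesis using j(2) by simp
  qed
  have n: "nested (join v (ys # zss))"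
  proof (rule 3(1))
    show "\<forall>i j. i < j \<and> j < length (ys # zss) \<longrightarrow> set ((ys # zss) ! i) \<inter> set ((ys # zss) ! j) = {}"
    proof (intro allI impI)
      fix i j assume "i < j \<and> j < length (ys # zss)"
      then have "Suc i < Suc j \<and> Suc j < length (xs # ys # zss)" by simp
      then have "set ((xs # ys # zss) ! Suc i) \<inter> set ((xs # ys # zss) ! Suc j) = {}"
        by (rule 3(3)[rule_format])
      then show "set ((ys # zss) ! i) \<inter> set ((ys # zss) ! j) = {}" by simp
    qed
    show "\<forall>us \<in> set (ys # zss). nested us \<and> (\<forall>x \<in> set us. v < x)"
      using 3(2) by simp
  qed
  have s: "set (join v (ys # zss)) \<subseteq> insert v (\<Union> (set (map set (ys # zss))))"
    by (rule set_join)
  have ge: "\<forall>x \<in> set (join v (ys # zss)). v \<le> x"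
  proof
    fix x assume "x \<in> set (join v (ys # zss))"
    then have "x = v \<or> (\<exists>us \<in> set (ys # zss). x \<in> set us)" using s by auto
    moreover have "v \<le> x" if "us \<in> set (ys # zss)" "x \<in> set us" for us
      using that 3(2) less_imp_le by (metis list.set_intros(2))
    ultimately show "v \<le> x" by blast
  qed
  have n1: "nested ([v] @ join v (ys # zss))"
  proof (rule nested_append[OF _ n, where v = v])
    show "nested [v]" by (simp add: nested_def)
    show "\<forall>x \<in> set [v] \<union> set (join v (ys # zss)). v \<le> x" using ge by simp
  qed simp
  have "nested (xs @ ([v] @ join v (ys # zss)))"
  proof (rule nested_append[OF _ n1, where v = v])
    show "nested xs" using 3(2) by simp
    show "set xs \<inter> set ([v] @ join v (ys # zss)) \<subseteq> {v}"
    proof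
      fix x assume x: "x \<in> set xs \<inter> set ([v] @ join v (ys # zss))"
      then have "x = v \<or> (\<exists>us \<in> set (ys # zss). x \<in> set us)" using s by auto
      then show "x \<in> {v}" using x disj by blast
    qed
    have "\<forall>x \<in> set xs. v \<le> x" using 3(2) less_imp_le by (metis list.set_intros(1))
    then show "\<forall>x \<in> set xs \<union> set ([v] @ join v (ys # zss)). v \<le> x"
      using ge by auto
  qed
  then show ?case by (simp only: join.simps append.simps)
qed

lemma count_join:
  "count_list (join v xss) x =
     sum_list (map (\<lambda>xs. count_list xs x) xss) + (if x = v then length xss - 1 else 0)"
  by (induction v xss rule: join.induct) auto

lemma count_concat: "count_list (concat xss) x = sum_list (map (\<lambda>xs. count_list xs x) xss)"
  by (induction xss) auto

lemma subtrees_child: "s \<in> set ts \<Longrightarrow> subtrees s \<subseteq> subtrees (Node v ts)"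
  by auto

lemma count_code:
  assumes "\<forall>u ts. Node u ts \<in> subtrees t \<longrightarrow> length ts = k + 1"
  shows "count_list (code t) x = k * count_list (labels t) x"
  using assms
proof (induction t)
  case Empty
  then show ?case by simp
next
  case (Node v ts)
  have "count_list (code s) x = k * count_list (labels s) x" if "s \<in> set ts" for s
    using Node.IH[OF that] Node.prems subtrees_child[OF that] by blast
  then have "sum_list (map (\<lambda>s. count_list (code s) x) ts)
      = k * sum_list (map (\<lambda>s. count_list (labels s) x) ts)"
    by (simp add: sum_list_const_mult[symmetric] cong: map_cong)
  moreover have "length ts = k + 1" using Node.prems by auto
  ultimately show ?case
    by (simp add: count_join count_concat comp_def algebra_simps)
qed

lemma count_distinct: "distinct xs \<Longrightarrow> x \<in> set xs \<Longrightarrow> count_list xs x = 1"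
  by (induction xs) auto

lemma set_code: "set (code t) \<subseteq> set (labels t)"
proof (induction t)
  case (Node v ts)
  then show ?case using set_join[of v "map code ts"] by fastforce
qed simp

lemma labels_greater:
  assumes "\<forall>u j v. child_at (Node a ts) u j v \<longrightarrow> u < v" "s \<in> set ts" "x \<in> set (labels s)"
  shows "a < x"
  using assms
proof (induction s arbitrary: a ts)
  case Empty
  then show ?case by simp
next
  case (Node b us)
  obtain i where i: "i < length ts" "ts ! i = Node b us"
    using Node.prems(2) by (metis in_set_conv_nth)
  have "child_at (Node a ts) a (Suc i) b"
    unfolding child_at_def using i by auto
  then have ab: "a < b" using Node.prems(1) by blast
  have "\<forall>u j v. child_at (Node b us) u j v \<longrightarrow> u < v"
    using Node.prems(1) subtrees_child[OF Node.prems(2), of a]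
    unfolding child_at_def by blast
  then show ?case using ab Node.IH Node.prems(3) by fastforce
qed

lemma nested_code:
  assumes "distinct (labels t)" "\<forall>u j v. child_at t u j v \<longrightarrow> u < v"
  shows "nested (code t)"
  using assms
proof (induction t)
  case Empty
  then show ?case by (simp add: nested_def)
next
  case (Node v ts)
  have d: "distinct (concat (map labels ts))" using Node.prems(1) by simp
  have "nested (code s) \<and> (\<forall>x \<in> set (code s). v < x)" if s: "s \<in> set ts" for s
  proof
    have "distinct (labels s)"
      using d s by (auto simp: distinct_concat_iff)
    moreover have "\<forall>u j v. child_at s u j v \<longrightarrow> u < v"
      using Node.prems(2) subtrees_child[OF s, of v] unfolding child_at_def by blast
    ultimately show "nested (code s)" using Node.IH[OF s] by blast
    show "\<forall>x \<in> set (code s). v < x"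
      using labels_greater[OF Node.prems(2) s] set_code by blast
  qed
  moreover have "set (map code ts ! i) \<inter> set (map code ts ! j) = {}"
    if "i < j \<and> j < length (map code ts)" for i j
  proof -
    have ij: "i < j" "j < length ts" using that by auto
    have "ts = take j ts @ drop j ts" by simp
    then have "distinct (concat (map labels (take j ts)) @ concat (map labels (drop j ts)))"
      using d by (metis concat_append map_append)
    then have disj: "set (concat (map labels (take j ts))) \<inter> set (concat (map labels (drop j ts))) = {}"
      by simp
    have "ts ! i \<in> set (take j ts)" "ts ! j \<in> set (drop j ts)"
      using ij by (auto simp: in_set_conv_nth intro: exI[of _ i] exI[of _ 0])
    then have "set (labels (ts ! i)) \<inter> set (labels (ts ! j)) = {}"
      using disj by fastforce
    then show ?thesis using set_code[of "ts ! i"] set_code[of "ts ! j"] ij by auto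
  qed
  ultimately have "nested (join v (map code ts))"
    by (intro nested_join) auto
  then show ?case by simp
qed

lemma stirling_perm_code:
  assumes "increasing_tree k n t"
  shows "stirling_perm k n (code t)"
proof -
  have v: "set (labels t) = {1..n}" and d: "distinct (labels t)"
    and l: "\<forall>u ts. Node u ts \<in> subtrees t \<longrightarrow> length ts = k + 1"
    and c: "\<forall>u j v. child_at t u j v \<longrightarrow> u < v"
    using assms unfolding increasing_tree_def vertices_def by blast+
  have "count_list (code t) i = k" if "i \<in> {1..n}" for i
  proof -
    have "count_list (labels t) i = 1"
      using that v d by (metis count_distinct)
    then show ?thesis using count_code[OF l] by simp
  qed
  moreover have "entry (code t) p \<le> entry (code t) r"
    if h: "1 \<le> p \<and> p < r \<and> r < q \<and> q \<le> length (code t) \<and> entry (code t) p = entry (code t) q"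
    for p q r
  proof -
    have e: "entry (code t) i = code t ! (i - 1)" if "1 \<le> i" "i \<le> length (code t)" for i
      using that by (cases i) (simp_all add: entry_def nth_append)
    have "code t ! (p - 1) = code t ! (q - 1)" using h e[of p] e[of q] by simp
    moreover have "p - 1 < r - 1" "r - 1 < q - 1" "q - 1 < length (code t)" using h by auto
    ultimately have "code t ! (p - 1) \<le> code t ! (r - 1)"
      using nested_code[OF d c] unfolding nested_def by blast
    then show ?thesis using h e[of p] e[of r] by simp
  qed
  ultimately show ?thesis
    using set_code[of t] v unfolding stirling_perm_def by blast
qed

end

theory Submission
  imports Defs
begin

text \<open>
  The letters of \<open>code t\<close> correspond to pairs of a vertex \<open>v\<close> and an occurrence number \<open>j \<le> k\<close>,
  and the \<open>j\<close>-th copy of \<open>v\<close> stands between the codes of the subtrees of \<open>v\<close> in positions \<open>j\<close>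
  and \<open>j + 1\<close>.  A nonempty subtree contributes a neighbour larger than \<open>v\<close>; next to an empty
  position the neighbour is another copy of \<open>v\<close> or, at the two ends of the code of the subtree
  rooted at \<open>v\<close>, a smaller letter.  Hence each statistic counts the vertices at which some
  position is empty, or occupied.

  For the blocks, write \<open>code t = A @ code s @ B\<close> with \<open>s\<close> the subtree rooted at \<open>v\<close>.  The copies
  of \<open>v\<close> span a block iff no letter occurs both in \<open>A\<close> and in \<open>B\<close>.  Passing from a vertex to a
  child preserves this in the two outer positions, and destroys it in the inner ones, where the
  parent occurs on both sides.
\<close>

section \<open>Vertices, parents and children\<close>

text \<open>The hereditary part of \<open>increasing_tree\<close>: without the conditions that fix
  the root label and the vertex set, the property passes to every subtree and supports induction on
  trees.\<close>

definition inc :: "nat \<Rightarrow> ptree \<Rightarrow> bool" where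
  "inc k t \<longleftrightarrow> distinct (labels t)
     \<and> (\<forall>u ts. Node u ts \<in> subtrees t \<longrightarrow> length ts = k + 1)
     \<and> (\<forall>u j v. child_at t u j v \<longrightarrow> u < v)"

lemma child_at_mono: "subtrees s \<subseteq> subtrees t \<Longrightarrow> child_at s u j v \<Longrightarrow> child_at t u j v"
  unfolding child_at_def by blast

lemma inc_child:
  assumes "inc k (Node v ts)" "s \<in> set ts"
  shows "inc k s"
proof -
  have "distinct (labels s)"
    using assms unfolding inc_def by (auto simp: distinct_concat_iff)
  then show ?thesis
    using assms subtrees_child[OF assms(2), of v] child_at_mono unfolding inc_def by blast
qed

lemma inc_subtree: "inc k t \<Longrightarrow> s \<in> subtrees t \<Longrightarrow> inc k s"
proof (induction t)
  case (Node v ts)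
  show ?case
  proof (cases "s = Node v ts")
    case False
    then obtain r where "r \<in> set ts" "s \<in> subtrees r" using Node.prems(2) by auto
    then show ?thesis using Node.IH inc_child[OF Node.prems(1)] by blast
  qed (use Node.prems in simp)
qed simp

lemma inc_greater: "inc k (Node v ts) \<Longrightarrow> s \<in> set ts \<Longrightarrow> x \<in> set (labels s) \<Longrightarrow> v < x"
  using labels_greater unfolding inc_def by blast

lemma inc_length: "inc k (Node v ts) \<Longrightarrow> length ts = k + 1"
  unfolding inc_def by simp

lemma labels_subtree: "Node v ts \<in> subtrees t \<Longrightarrow> v \<in> set (labels t)"
  by (induction t) auto

lemma labels_iff_subtree: "v \<in> set (labels t) \<longleftrightarrow> (\<exists>ts. Node v ts \<in> subtrees t)"
  by (induction t) auto

lemma disjoint_children: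
  assumes "distinct (concat (map f ts))" "i < length ts" "j < length ts"
    "x \<in> set (f (ts ! i))" "x \<in> set (f (ts ! j))"
  shows "i = j"
  using assms
proof (induction ts arbitrary: i j)
  case (Cons t ts)
  show ?case
  proof (cases i)
    case 0
    then show ?thesis using Cons.prems by (cases j) (auto simp: disjoint_iff)
  next
    case (Suc i')
    then show ?thesis using Cons by (cases j) (auto simp: disjoint_iff)
  qed
qed simp

text \<open>The root label cannot recur below the root, since labels there are larger, and any other
  label lies in a single child. This lets a vertex stand for the subtree below it.\<close>

lemma subtree_unique:
  assumes "inc k t" "Node v ts \<in> subtrees t" "Node v us \<in> subtrees t"
  shows "ts = us"
  using assms
proof (induction t)
  case (Node r rs)
  have r: "r \<notin> set (labels s)" if "s \<in> set rs" for s
    using inc_greater[OF Node.prems(1) that] by blast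
  show ?case
  proof (cases "v = r")
    case True
    then show ?thesis using Node.prems r labels_subtree by fastforce
  next
    case False
    then obtain i j where i: "i < length rs" "Node v ts \<in> subtrees (rs ! i)"
      and j: "j < length rs" "Node v us \<in> subtrees (rs ! j)"
      using Node.prems by (auto simp: in_set_conv_nth)
    then have "i = j"
      using disjoint_children[of labels rs i j v] Node.prems(1) labels_subtree
      unfolding inc_def by auto
    then show ?thesis using Node.IH[of "rs ! i"] inc_child[OF Node.prems(1)] i j by auto
  qed
qed simp

lemma child_at_Node:
  "child_at (Node r ts) u j v \<longleftrightarrow>
     (u = r \<and> 1 \<le> j \<and> j \<le> length ts \<and> (\<exists>us. ts ! (j - 1) = Node v us))
     \<or> (\<exists>s \<in> set ts. child_at s u j v)"
  unfolding child_at_def by auto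

lemma child_at_labels:
  assumes "child_at t u j v"
  shows "u \<in> set (labels t)" "v \<in> set (labels t)"
proof -
  obtain ts us where n: "Node u ts \<in> subtrees t" "1 \<le> j" "j \<le> length ts" "ts ! (j - 1) = Node v us"
    using assms unfolding child_at_def by blast
  then show "u \<in> set (labels t)" using labels_subtree by blast
  have sub: "Node v us \<in> set ts" using n nth_mem[of "j - 1" ts] by auto
  have "Node v us \<in> subtrees (Node u ts)" using sub by force
  moreover have "s \<in> subtrees t \<Longrightarrow> subtrees s \<subseteq> subtrees t" for s by (induction t) auto
  ultimately have "Node v us \<in> subtrees t" using n(1) by blast
  then show "v \<in> set (labels t)" using labels_subtree by blast
qed

lemma parent_exists:
  "v \<in> set (labels t) \<Longrightarrow> \<forall>ts. t \<noteq> Node v ts \<Longrightarrow> \<exists>u j. child_at t u j v"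
proof (induction t)
  case (Node r ts)
  then obtain s where s: "s \<in> set ts" "v \<in> set (labels s)" by auto
  show ?case
  proof (cases "\<exists>us. s = Node v us")
    case True
    obtain i where "i < length ts" "ts ! i = s" using s by (auto simp: in_set_conv_nth)
    then have "child_at (Node r ts) r (Suc i) v" using True by (auto simp: child_at_Node)
    then show ?thesis by blast
  next
    case False
    then show ?thesis using Node.IH[OF s] s by (auto simp: child_at_Node)
  qed
qed simp

lemma root_no_parent:
  assumes "inc k (Node r ts)"
  shows "\<not> child_at (Node r ts) u j r"
proof
  assume c: "child_at (Node r ts) u j r"
  then have "u < r" using assms unfolding inc_def by blast
  moreover have "u = r \<or> (\<exists>s \<in> set ts. u \<in> set (labels s))"
    using child_at_labels(1)[OF c] by auto
  ultimately show False using inc_greater[OF assms] by fastforce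
qed

text \<open>By distinctness \<open>v\<close> lies in exactly one child of the root. Either it is the
  root of that child, or its parent lies inside the child; \<open>root_no_parent\<close> excludes
  both at once.\<close>

lemma parent_unique:
  assumes "inc k t" "child_at t u j v" "child_at t u' j' v"
  shows "u = u' \<and> j = j'"
  using assms
proof (induction t)
  case Empty
  then show ?case by (simp add: child_at_def)
next
  case (Node r rs)
  have ex: "\<exists>i < length rs. v \<in> set (labels (rs ! i)) \<and>
      (a = r \<and> b = Suc i \<and> (\<exists>us. rs ! i = Node v us) \<or> child_at (rs ! i) a b v)"
    if "child_at (Node r rs) a b v" for a b
    using that unfolding child_at_Node
  proof (elim disjE)
    assume "a = r \<and> 1 \<le> b \<and> b \<le> length rs \<and> (\<exists>us. rs ! (b - 1) = Node v us)"
    then show ?thesis by (intro exI[of _ "b - 1"]) auto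
  next
    assume "\<exists>s \<in> set rs. child_at s a b v"
    then show ?thesis using child_at_labels(2) by (auto simp: in_set_conv_nth) blast
  qed
  from ex[OF Node.prems(2)] obtain i where i: "i < length rs" "v \<in> set (labels (rs ! i))"
    "u = r \<and> j = Suc i \<and> (\<exists>us. rs ! i = Node v us) \<or> child_at (rs ! i) u j v" by blast
  from ex[OF Node.prems(3)] obtain i' where i': "i' < length rs" "v \<in> set (labels (rs ! i'))"
    "u' = r \<and> j' = Suc i' \<and> (\<exists>us. rs ! i' = Node v us) \<or> child_at (rs ! i') u' j' v" by blast
  have "i' = i"
    using disjoint_children[of labels rs i i' v] Node.prems(1) i i' unfolding inc_def by auto
  have inc: "inc k (rs ! i)" using inc_child[OF Node.prems(1)] i(1) by simp
  have no: "\<not> (rs ! i = Node v us \<and> child_at (rs ! i) a b v)" for us a b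
    using root_no_parent inc by auto
  have "child_at (rs ! i) u j v \<Longrightarrow> child_at (rs ! i) u' j' v \<Longrightarrow> u = u' \<and> j = j'"
    using Node.IH[OF nth_mem[OF i(1)] inc] .
  then show ?case using i(3) i'(3) no unfolding \<open>i' = i\<close> by blast
qed

section \<open>Subwords coding subtrees\<close>

text \<open>Applied to the subtrees left of a given position, this is the part of the code of
  \<open>v\<close> before the code at that position, closing separator included; \<open>post\<close>
  is the mirror image.\<close>

definition pre :: "nat \<Rightarrow> ptree list \<Rightarrow> nat list" where
  "pre v ts = concat (map (\<lambda>s. code s @ [v]) ts)"

definition post :: "nat \<Rightarrow> ptree list \<Rightarrow> nat list" where
  "post v ts = concat (map (\<lambda>s. v # code s) ts)"

lemma join_Cons: "join v (ys # zss) = ys @ concat (map ((#) v) zss)"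
  by (induction zss arbitrary: ys) auto

lemma join_append:
  "join v (xss @ ys # zss) = concat (map (\<lambda>xs. xs @ [v]) xss) @ join v (ys # zss)"
proof (induction xss)
  case (Cons xs xss)
  then show ?case by (cases xss) auto
qed simp

lemma code_split:
  assumes "i < length ts"
  shows "code (Node v ts) = pre v (take i ts) @ code (ts ! i) @ post v (drop (Suc i) ts)"
proof -
  have "code (Node v ts) = join v (map code (take i ts) @ code (ts ! i) # map code (drop (Suc i) ts))"
    using arg_cong[OF id_take_nth_drop[OF assms], of "\<lambda>us. code (Node v us)"] by simp
  then show ?thesis
    unfolding join_append join_Cons pre_def post_def by (simp add: comp_def)
qed

lemma pre_Suc: "i < length ts \<Longrightarrow> pre v (take (Suc i) ts) = pre v (take i ts) @ code (ts ! i) @ [v]"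
  by (simp add: pre_def take_Suc_conv_app_nth)

lemma post_Suc: "i < length ts \<Longrightarrow> post v (drop i ts) = v # code (ts ! i) @ post v (drop (Suc i) ts)"
  by (simp add: post_def Cons_nth_drop_Suc[symmetric])

text \<open>The context of \<open>code s\<close> as a factor of \<open>code t\<close>. The zeros in
  \<open>0 # A\<close> and \<open>B @ [0]\<close> supply the boundary letters of the word when
  \<open>A\<close> or \<open>B\<close> is empty.\<close>

definition embedded :: "ptree \<Rightarrow> nat list \<Rightarrow> ptree \<Rightarrow> nat list \<Rightarrow> bool" where
  "embedded t A s B \<longleftrightarrow> code t = A @ code s @ B \<and> set (A @ B) \<inter> set (labels s) = {}
     \<and> (\<forall>x \<in> set (labels s). last (0 # A) < x \<and> hd (B @ [0]) < x)"

lemma set_pre: "set (pre v ts) \<subseteq> insert v (\<Union>s \<in> set ts. set (labels s))"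
  by (auto simp: pre_def dest: subsetD[OF set_code])

lemma set_post: "set (post v ts) \<subseteq> insert v (\<Union>s \<in> set ts. set (labels s))"
  by (auto simp: post_def dest: subsetD[OF set_code])

text \<open>The outermost positions inherit the outer neighbour from the context of
  \<open>v\<close>; at any other side the neighbour is a copy of \<open>v\<close>, which is smaller
  than all labels of the child. Siblings share no label with it.\<close>

lemma embedded_child:
  assumes "inc k (Node v ts)" "embedded t A (Node v ts) B" "i < length ts"
  shows "embedded t (A @ pre v (take i ts)) (ts ! i) (post v (drop (Suc i) ts) @ B)"
proof -
  have e: "code t = A @ code (Node v ts) @ B" "set (A @ B) \<inter> set (labels (Node v ts)) = {}"
    "\<forall>x \<in> set (labels (Node v ts)). last (0 # A) < x \<and> hd (B @ [0]) < x"
    using assms(2) unfolding embedded_def by auto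
  have gt: "v < x" if "x \<in> set (labels (ts ! i))" for x
    using inc_greater[OF assms(1) nth_mem[OF assms(3)] that] .
  have sub: "set (labels (ts ! i)) \<subseteq> set (labels (Node v ts))"
    using assms(3) by auto
  have disj: "x \<notin> set (labels s)"
    if s: "s \<in> set (take i ts) \<union> set (drop (Suc i) ts)" and x: "x \<in> set (labels (ts ! i))" for s x
  proof
    assume "x \<in> set (labels s)"
    moreover obtain j where "j < length ts" "j \<noteq> i" "ts ! j = s"
    proof -
      consider j where "j < i" "ts ! j = s" | j where "j < length ts - Suc i" "ts ! (Suc i + j) = s"
        using s assms(3) by (auto simp: in_set_conv_nth)
      then show thesis
      proof cases
        case (1 j)
        then show ?thesis using that[of j] assms(3) by simp
      next
        case (2 j)
        then show ?thesis using that[of "Suc i + j"] assms(3) by simp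
      qed
    qed
    ultimately show False
      using disjoint_children[of labels ts i j x] assms x unfolding inc_def by auto
  qed
  have "set (pre v (take i ts)) \<inter> set (labels (ts ! i)) = {}"
    using set_pre[of v "take i ts"] disj gt by blast
  moreover have "set (post v (drop (Suc i) ts)) \<inter> set (labels (ts ! i)) = {}"
    using set_post[of v "drop (Suc i) ts"] disj gt by blast
  ultimately have 1: "set ((A @ pre v (take i ts)) @ (post v (drop (Suc i) ts) @ B))
      \<inter> set (labels (ts ! i)) = {}"
    using e(2) sub unfolding set_append by blast
  have 2: "last (0 # A @ pre v (take i ts)) < x" if x: "x \<in> set (labels (ts ! i))" for x
  proof (cases i)
    case 0
    then show ?thesis using e(3) sub x by (auto simp: pre_def)
  next
    case (Suc j)
    then show ?thesis using pre_Suc[of j ts v] assms(3) gt[OF x] by simp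
  qed
  have 3: "hd ((post v (drop (Suc i) ts) @ B) @ [0]) < x" if x: "x \<in> set (labels (ts ! i))" for x
  proof (cases "Suc i < length ts")
    case False
    then show ?thesis using e(3) sub x by (auto simp: post_def)
  next
    case True
    then show ?thesis using post_Suc[of "Suc i" ts v] gt[OF x] by simp
  qed
  show ?thesis
    unfolding embedded_def using 1 2 3 e(1) code_split[OF assms(3), of v] by simp
qed

lemma embedded_subtree:
  "inc k s \<Longrightarrow> embedded t A s B \<Longrightarrow> s' \<in> subtrees s \<Longrightarrow> \<exists>A' B'. embedded t A' s' B'"
proof (induction s arbitrary: A B)
  case (Node v ts)
  show ?case
  proof (cases "s' = Node v ts")
    case True
    then show ?thesis using Node.prems by blast
  next
    case False
    then obtain i where i: "i < length ts" "s' \<in> subtrees (ts ! i)"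
      using Node.prems by (auto simp: in_set_conv_nth)
    have s: "ts ! i \<in> set ts" using i(1) by simp
    show ?thesis
      by (rule Node.IH[OF s inc_child[OF Node.prems(1) s] embedded_child[OF Node.prems(1,2) i(1)] i(2)])
  qed
qed simp

section \<open>Neighbours of a letter\<close>

lemma entry_nth: "1 \<le> i \<Longrightarrow> i \<le> length w \<Longrightarrow> entry w i = w ! (i - 1)"
  by (cases i) (simp_all add: entry_def nth_append)

lemma entry_last: "entry (P @ Q) (length P) = last (0 # P)"
  by (cases P rule: rev_cases) (simp_all add: entry_def nth_append)

lemma entry_hd: "entry (P @ Q) (Suc (length P)) = hd (Q @ [0])"
  by (cases Q) (simp_all add: entry_def nth_append)

lemma entry_0 [simp]: "entry w 0 = 0"
  by (simp add: entry_def)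

lemma entry_end [simp]: "entry w (Suc (length w)) = 0"
  by (simp add: entry_def nth_append)

lemma occ_count:
  assumes "1 \<le> i" "i \<le> length w"
  shows "occ w i = count_list (take i w) (entry w i)"
proof -
  have "{p \<in> {1..i}. entry w p = entry w i} = Suc ` {p. p < i \<and> w ! p = entry w i}"
  proof (intro set_eqI iffI)
    fix p assume "p \<in> {p \<in> {1..i}. entry w p = entry w i}"
    then show "p \<in> Suc ` {p. p < i \<and> w ! p = entry w i}"
      using assms by (cases p) (auto simp: entry_nth)
  qed (use assms in \<open>auto simp: entry_nth\<close>)
  then have "occ w i = card {p. p < i \<and> w ! p = entry w i}"
    unfolding occ_def by (simp add: card_image)
  also have "{p. p < i \<and> w ! p = entry w i}
      = {p. p < length (take i w) \<and> entry w i = take i w ! p}"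
    using assms by auto
  finally show ?thesis
    by (simp add: count_list_eq_length_filter length_filter_conv_card)
qed

text \<open>Along the positions of a fixed value the occurrence number strictly increases, so value
  and occurrence number together identify a position.\<close>

lemma occ_inj:
  assumes "1 \<le> i" "1 \<le> i'" "entry w i = entry w i'" "occ w i = occ w i'"
  shows "i = i'"
proof (rule ccontr)
  have less: "occ w a < occ w b" if "1 \<le> a" "a < b" "entry w a = entry w b" for a b
  proof -
    have "{p \<in> {1..a}. entry w p = entry w a} \<subseteq> {p \<in> {1..b}. entry w p = entry w b}"
      using that by auto
    moreover have "b \<in> {p \<in> {1..b}. entry w p = entry w b}"
      "b \<notin> {p \<in> {1..a}. entry w p = entry w a}" using that by auto
    ultimately show ?thesis unfolding occ_def by (intro psubset_card_mono) (simp, blast)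
  qed
  assume "i \<noteq> i'"
  then show False using less[of i i'] less[of i' i] assms by linarith
qed

text \<open>With \<open>k \<ge> 1\<close> there are at least two positions, hence a separator
  \<open>v\<close>. This is why a nonempty subtree contributes at least one letter.\<close>

lemma root_in_code:
  assumes "inc k (Node v ts)" "k \<ge> 1"
  shows "v \<in> set (code (Node v ts))"
  using code_split[of 0 ts v] post_Suc[of 1 ts v] inc_length[OF assms(1)] assms(2)
  by (simp del: code.simps)

lemma count_pre: "(\<forall>s \<in> set ts. v \<notin> set (code s)) \<Longrightarrow> count_list (pre v ts) v = length ts"
  by (induction ts) (simp_all add: pre_def)

text \<open>Here \<open>j\<close> counts the earlier copies of \<open>v\<close>, so the copy shown
  is number \<open>j + 1\<close> and stands between the list entries \<open>ts ! j\<close> and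
  \<open>ts ! Suc j\<close>. An empty entry exposes the previous or next copy of \<open>v\<close>,
  or at the first and last positions the smaller letter of the context.\<close>

lemma occurrence:
  assumes "inc k (Node v ts)" "embedded t A (Node v ts) B" "j < k"
  obtains P Q where "code t = P @ v # Q" "count_list P v = j"
    "if ts ! j = Empty then if j = 0 then last (0 # P) < v else last (0 # P) = v
     else v < last (0 # P)"
    "if ts ! Suc j = Empty then if Suc j = k then hd (Q @ [0]) < v else hd (Q @ [0]) = v
     else v < hd (Q @ [0])"
proof
  define P where "P = A @ pre v (take j ts) @ code (ts ! j)"
  define Q where "Q = code (ts ! Suc j) @ post v (drop (Suc (Suc j)) ts) @ B"
  have len: "length ts = k + 1" using inc_length[OF assms(1)] .
  have e: "code t = A @ code (Node v ts) @ B" "v \<notin> set A" "v \<notin> set B"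
    "last (0 # A) < v" "hd (B @ [0]) < v"
    using assms(2) unfolding embedded_def by auto
  have gt: "\<forall>x \<in> set (code s). v < x" if "s \<in> set ts" for s
    using inc_greater[OF assms(1) that] set_code by blast
  have ne: "code s \<noteq> []" if s: "s \<in> set ts" "s \<noteq> Empty" for s
  proof -
    obtain u us where "s = Node u us" using s(2) by (cases s) auto
    then show ?thesis
      using root_in_code[of k u us] inc_child[OF assms(1) s(1)] assms(3) by (auto simp del: code.simps)
  qed
  have mem: "ts ! j \<in> set ts" "ts ! Suc j \<in> set ts" using len assms(3) by auto
  show "code t = P @ v # Q"
    using e(1) code_split[of "Suc j" ts v] pre_Suc[of j ts v] len assms(3)
    unfolding P_def Q_def by simp
  have "count_list (pre v (take j ts)) v = j"
    using count_pre[of "take j ts" v] gt set_take_subset[of j ts] len assms(3) by fastforce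
  moreover have "count_list A v = 0" "count_list (code (ts ! j)) v = 0"
    using e(2) gt[OF mem(1)] by (auto simp: count_list_0_iff)
  ultimately show "count_list P v = j" unfolding P_def by simp
  have l1: "v < last (0 # P)" if "ts ! j \<noteq> Empty"
    using ne[OF mem(1) that] gt[OF mem(1)] unfolding P_def by simp
  have l2: "last (0 # P) < v" if "ts ! j = Empty" "j = 0"
    using that e(4) unfolding P_def by (simp add: pre_def)
  have l3: "last (0 # P) = v" if e: "ts ! j = Empty" "j \<noteq> 0"
  proof -
    obtain i where "j = Suc i" using e(2) by (cases j) auto
    then show ?thesis using e pre_Suc[of i ts v] len assms(3) unfolding P_def by simp
  qed
  have r1: "v < hd (Q @ [0])" if "ts ! Suc j \<noteq> Empty"
    using ne[OF mem(2) that] gt[OF mem(2)] unfolding Q_def by simp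
  have r2: "hd (Q @ [0]) < v" if "ts ! Suc j = Empty" "Suc j = k"
    using that e(5) len unfolding Q_def by (simp add: post_def)
  have r3: "hd (Q @ [0]) = v" if "ts ! Suc j = Empty" "Suc j \<noteq> k"
    using that post_Suc[of "Suc (Suc j)" ts v] len assms(3) unfolding Q_def by simp
  show "if ts ! j = Empty then if j = 0 then last (0 # P) < v else last (0 # P) = v
     else v < last (0 # P)"
    using l1 l2 l3 by simp
  show "if ts ! Suc j = Empty then if Suc j = k then hd (Q @ [0]) < v else hd (Q @ [0]) = v
     else v < hd (Q @ [0])"
    using r1 r2 r3 by simp
qed

section \<open>A fixed increasing tree and the letters of its word\<close>

locale increasing =
  fixes k n :: nat and t :: ptree and w :: "nat list"
  assumes k: "k \<ge> 1" and t: "increasing_tree k n t"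
  defines "w \<equiv> code t"
begin

lemma inc: "inc k t"
  using t unfolding increasing_tree_def inc_def by blast

lemma labels_t: "set (labels t) = {1..n}"
  using t unfolding increasing_tree_def vertices_def by blast

lemma stirling: "stirling_perm k n w"
  using stirling_perm_code[OF t] unfolding w_def .

lemma embedded_vertex:
  assumes "v \<in> {1..n}"
  obtains ts A B where "Node v ts \<in> subtrees t" "inc k (Node v ts)" "embedded t A (Node v ts) B"
proof -
  obtain ts where ts: "Node v ts \<in> subtrees t"
    using assms labels_t labels_iff_subtree by blast
  \<comment> \<open>All labels are at least 1, so the boundary zeros are smaller, as the empty
    context requires.\<close>
  have "embedded t [] t []" using labels_t unfolding embedded_def by simp
  then show ?thesis using that embedded_subtree[OF inc] inc_subtree[OF inc] ts by blast
qed

lemma empty_at_iff: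
  assumes "Node v ts \<in> subtrees t" "1 \<le> j" "j \<le> k + 1"
  shows "empty_at t v j \<longleftrightarrow> ts ! (j - 1) = Empty"
proof -
  have "length ts = k + 1" using inc_length inc_subtree[OF inc assms(1)] by blast
  then show ?thesis
    using subtree_unique[OF inc assms(1)] assms unfolding empty_at_def by metis
qed

text \<open>\<open>occurrence\<close> restated with positions of the word. Occurrence numbers now
  start at 1, hence the index \<open>j - 1\<close>; the position is
  \<open>Suc (length P)\<close>.\<close>

lemma letter:
  assumes "v \<in> {1..n}" "1 \<le> j" "j \<le> k"
  obtains i where "1 \<le> i" "i \<le> length w" "entry w i = v" "occ w i = j"
    "if empty_at t v j then if j = 1 then entry w (i - 1) < v else entry w (i - 1) = v
     else v < entry w (i - 1)"
    "if empty_at t v (j + 1) then if j = k then entry w (i + 1) < v else entry w (i + 1) = v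
     else v < entry w (i + 1)"
proof -
  obtain ts A B where ts: "Node v ts \<in> subtrees t"
    and em: "inc k (Node v ts)" "embedded t A (Node v ts) B"
    using embedded_vertex[OF assms(1)] .
  have j: "j - 1 < k" "Suc (j - 1) = j" and j1: "j - 1 = 0 \<longleftrightarrow> j = 1" using assms by auto
  have empty: "empty_at t v j \<longleftrightarrow> ts ! (j - 1) = Empty" "empty_at t v (j + 1) \<longleftrightarrow> ts ! j = Empty"
    using empty_at_iff[OF ts, of j] empty_at_iff[OF ts, of "j + 1"] assms by auto
  obtain P Q where P: "code t = P @ v # Q" "count_list P v = j - 1"
    and n: "if ts ! (j - 1) = Empty then if j - 1 = 0 then last (0 # P) < v else last (0 # P) = v
     else v < last (0 # P)"
    "if ts ! j = Empty then if j = k then hd (Q @ [0]) < v else hd (Q @ [0]) = v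
     else v < hd (Q @ [0])"
    using occurrence[OF em j(1), unfolded j(2)] .
  have en: "entry w (length P) = last (0 # P)" "entry w (Suc (length P)) = v"
    "entry w (Suc (Suc (length P))) = hd (Q @ [0])"
    using entry_last[of P "v # Q"] entry_hd[of P "v # Q"] entry_hd[of "P @ [v]" Q] P(1)
    unfolding w_def by auto
  have "occ w (Suc (length P)) = j"
    using occ_count[of "Suc (length P)" w] en(2) P j unfolding w_def by simp
  moreover have "1 \<le> Suc (length P)" "Suc (length P) \<le> length w"
    using P(1) unfolding w_def by auto
  moreover have "if empty_at t v j then if j = 1 then entry w (Suc (length P) - 1) < v
      else entry w (Suc (length P) - 1) = v else v < entry w (Suc (length P) - 1)"
    using n(1) unfolding diff_Suc_1 en(1) empty(1) j1 .
  moreover have "if empty_at t v (j + 1) then if j = k then entry w (Suc (length P) + 1) < v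
      else entry w (Suc (length P) + 1) = v else v < entry w (Suc (length P) + 1)"
    using n(2) unfolding empty(2) unfolding Suc_eq_plus1[symmetric] en(3) .
  ultimately show ?thesis using that en(2) by blast
qed

lemma letter_range:
  assumes "1 \<le> i" "i \<le> length w"
  shows "entry w i \<in> {1..n}" "1 \<le> occ w i" "occ w i \<le> k"
proof -
  show v: "entry w i \<in> {1..n}"
    using entry_nth[OF assms] stirling assms unfolding stirling_perm_def
    by (metis One_nat_def Suc_le_eq Suc_pred' le_trans less_eq_Suc_le nth_mem subsetD zero_less_one)
  have "count_list w (entry w i) = k" using v stirling unfolding stirling_perm_def by blast
  moreover have "count_list w (entry w i) = occ w i + count_list (drop i w) (entry w i)"
    unfolding occ_count[OF assms] by (metis append_take_drop_id count_list_append)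
  ultimately show "occ w i \<le> k" by simp
  have "i \<in> {p \<in> {1..i}. entry w p = entry w i}" using assms by simp
  then show "1 \<le> occ w i"
    using card_gt_0_iff[of "{p \<in> {1..i}. entry w p = entry w i}"]
    unfolding occ_def by (auto simp: Suc_le_eq)
qed

text \<open>\<open>letter\<close> yields some position carrying value \<open>v\<close> with
  occurrence number \<open>j\<close>; by \<open>occ_inj\<close> it is \<open>i\<close> itself. These
  equivalences translate all ascents, descents and plateaux into empty or occupied
  positions.\<close>

lemma neighbours:
  assumes i: "1 \<le> i" "i \<le> length w"
  defines "v \<equiv> entry w i" and "j \<equiv> occ w i"
  shows "v < entry w (i - 1) \<longleftrightarrow> \<not> empty_at t v j"
    "entry w (i - 1) < v \<longleftrightarrow> empty_at t v j \<and> j = 1"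
    "v < entry w (i + 1) \<longleftrightarrow> \<not> empty_at t v (j + 1)"
    "v = entry w (i + 1) \<longleftrightarrow> empty_at t v (j + 1) \<and> j \<noteq> k"
    "entry w (i + 1) < v \<longleftrightarrow> empty_at t v (j + 1) \<and> j = k"
proof -
  have r: "v \<in> {1..n}" "1 \<le> j" "j \<le> k" using letter_range[OF i] unfolding v_def j_def by auto
  obtain i' where i': "1 \<le> i'" "i' \<le> length w" "entry w i' = v" "occ w i' = j"
    and *: "if empty_at t v j then if j = 1 then entry w (i' - 1) < v else entry w (i' - 1) = v
     else v < entry w (i' - 1)"
    "if empty_at t v (j + 1) then if j = k then entry w (i' + 1) < v else entry w (i' + 1) = v
     else v < entry w (i' + 1)"
    using letter[OF r] .
  have "i' = i" using occ_inj[OF i'(1) i(1)] i'(3,4) unfolding v_def j_def .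
  note * = *[unfolded this]
  show "v < entry w (i - 1) \<longleftrightarrow> \<not> empty_at t v j"
    "entry w (i - 1) < v \<longleftrightarrow> empty_at t v j \<and> j = 1"
    using *(1) by (auto split: if_splits)
  show "v < entry w (i + 1) \<longleftrightarrow> \<not> empty_at t v (j + 1)"
    "v = entry w (i + 1) \<longleftrightarrow> empty_at t v (j + 1) \<and> j \<noteq> k"
    "entry w (i + 1) < v \<longleftrightarrow> empty_at t v (j + 1) \<and> j = k"
    using *(2) by (auto split: if_splits)
qed

section \<open>Ascents, descents and plateaux\<close>

text \<open>For a fixed occurrence number, reading off the letter is a bijection from positions of
  the word to vertices, so counting positions becomes counting vertices.\<close>

lemma card_letters:
  assumes "1 \<le> j" "j \<le> k"
  shows "card {i. 1 \<le> i \<and> i \<le> length w \<and> occ w i = j \<and> Q (entry w i)} = card {v \<in> {1..n}. Q v}"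
proof (rule bij_betw_same_card[of "entry w"], unfold bij_betw_def, intro conjI)
  show "inj_on (entry w) {i. 1 \<le> i \<and> i \<le> length w \<and> occ w i = j \<and> Q (entry w i)}"
    using occ_inj by (auto intro!: inj_onI)
  show "entry w ` {i. 1 \<le> i \<and> i \<le> length w \<and> occ w i = j \<and> Q (entry w i)} = {v \<in> {1..n}. Q v}"
  proof (intro equalityI subsetI)
    fix v assume v: "v \<in> {v \<in> {1..n}. Q v}"
    then obtain i where "1 \<le> i" "i \<le> length w" "entry w i = v" "occ w i = j"
      using letter[of v j] assms by blast
    then show "v \<in> entry w ` {i. 1 \<le> i \<and> i \<le> length w \<and> occ w i = j \<and> Q (entry w i)}"
      using v by blast
  qed (use letter_range in blast)
qed

section \<open>Counting empty and occupied positions\<close>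

lemma L_eq: "L t j = card {v \<in> {1..n}. empty_at t v j}"
  unfolding L_def vertices_def labels_t ..

lemma child_at_iff_nonempty:
  assumes "v \<in> {1..n}" "1 \<le> j" "j \<le> k + 1"
  shows "(\<exists>c. child_at t v j c) \<longleftrightarrow> \<not> empty_at t v j"
proof -
  obtain ts where ts: "Node v ts \<in> subtrees t" "inc k (Node v ts)"
    using embedded_vertex[OF assms(1)] by blast
  have "Node v us \<in> subtrees t \<longleftrightarrow> us = ts" for us
    using subtree_unique[OF inc ts(1)] ts(1) by blast
  then have "(\<exists>c. child_at t v j c) \<longleftrightarrow> (\<exists>c us. ts ! (j - 1) = Node c us)"
    using inc_length[OF ts(2)] assms unfolding child_at_def by simp
  then show ?thesis
    using empty_at_iff[OF ts(1) assms(2,3)] by (cases "ts ! (j - 1)") auto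
qed

lemma child_unique:
  assumes "child_at t u j v" "child_at t u j v'"
  shows "v = v'"
proof -
  obtain ts us where "Node u ts \<in> subtrees t" "ts ! (j - 1) = Node v us"
    using assms(1) unfolding child_at_def by blast
  moreover obtain ts' us' where "Node u ts' \<in> subtrees t" "ts' ! (j - 1) = Node v' us'"
    using assms(2) unfolding child_at_def by blast
  ultimately show ?thesis using subtree_unique[OF inc] by force
qed

text \<open>\<open>D\<close> counts children, whereas the word statistics see parents. Sending a
  vertex to its child in position \<open>j\<close> is a bijection, injective because parents are
  unique.\<close>

lemma D_eq:
  assumes "1 \<le> j" "j \<le> k + 1"
  shows "D t j = card {v \<in> {1..n}. \<not> empty_at t v j}"
proof -
  let ?c = "\<lambda>u. THE v. child_at t u j v"
  have the: "?c u = v" if "child_at t u j v" for u v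
    using child_unique[OF _ that] that by blast
  have "bij_betw ?c {v \<in> {1..n}. \<not> empty_at t v j} {v \<in> vertices t. \<exists>u. child_at t u j v}"
    unfolding bij_betw_def
  proof
    have ex: "\<exists>v. child_at t u j v" if "u \<in> {v \<in> {1..n}. \<not> empty_at t v j}" for u
      using child_at_iff_nonempty[of u j] assms that by auto
    show "inj_on ?c {v \<in> {1..n}. \<not> empty_at t v j}"
      using ex the parent_unique[OF inc] by (intro inj_onI) metis
    show "?c ` {v \<in> {1..n}. \<not> empty_at t v j} = {v \<in> vertices t. \<exists>u. child_at t u j v}"
    proof (intro equalityI subsetI)
      fix v assume "v \<in> ?c ` {v \<in> {1..n}. \<not> empty_at t v j}"
      then obtain u where "u \<in> {v \<in> {1..n}. \<not> empty_at t v j}" "v = ?c u" by blast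
      then have "child_at t u j v" using ex the by metis
      then show "v \<in> {v \<in> vertices t. \<exists>u. child_at t u j v}"
        using child_at_labels(2) unfolding vertices_def by blast
    next
      fix v assume "v \<in> {v \<in> vertices t. \<exists>u. child_at t u j v}"
      then obtain u where u: "child_at t u j v" by blast
      then have "u \<in> {1..n}" using child_at_labels(1) labels_t by blast
      then have "u \<in> {v \<in> {1..n}. \<not> empty_at t v j}"
        using child_at_iff_nonempty[of u j] assms u by blast
      then show "v \<in> ?c ` {v \<in> {1..n}. \<not> empty_at t v j}" using the[OF u] by blast
    qed
  qed
  then show ?thesis unfolding D_def by (rule bij_betw_same_card[symmetric])
qed

lemma D_plus_L:
  assumes "1 \<le> j" "j \<le> k + 1"
  shows "D t j + L t j = n"
proof -
  have "card {v \<in> {1..n}. \<not> empty_at t v j} + card {v \<in> {1..n}. empty_at t v j}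
      = card ({v \<in> {1..n}. \<not> empty_at t v j} \<union> {v \<in> {1..n}. empty_at t v j})"
    by (rule card_Un_disjoint[symmetric]) auto
  also have "{v \<in> {1..n}. \<not> empty_at t v j} \<union> {v \<in> {1..n}. empty_at t v j} = {1..n}" by blast
  finally show ?thesis unfolding D_eq[OF assms] L_eq by simp
qed

section \<open>Statistics refined by occurrence number, then their totals\<close>

lemma Xj_eq:
  assumes "1 \<le> j" "j \<le> k"
  shows "Xj w j = D t (j + 1)"
proof -
  have "{i. 1 \<le> i \<and> i \<le> length w \<and> ascent w i \<and> occ w i = j}
      = {i. 1 \<le> i \<and> i \<le> length w \<and> occ w i = j \<and> \<not> empty_at t (entry w i) (j + 1)}"
    using neighbours(3) unfolding ascent_def by blast
  then show ?thesis
    unfolding Xj_def using card_letters[OF assms] D_eq[of "j + 1"] assms by simp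
qed

lemma Zj_eq:
  assumes "1 \<le> j" "j < k"
  shows "Zj w j = L t (j + 1)"
proof -
  have "{i. 1 \<le> i \<and> i \<le> length w \<and> plateau w i \<and> occ w i = j}
      = {i. 1 \<le> i \<and> i \<le> length w \<and> occ w i = j \<and> empty_at t (entry w i) (j + 1)}"
    using neighbours(4) assms unfolding plateau_def by blast
  then show ?thesis
    unfolding Zj_def L_eq using card_letters[of j "\<lambda>v. empty_at t v (j + 1)"] assms by simp
qed

text \<open>A \<open>j\<close>-descent is classified by its right-hand letter, so \<open>Suc\<close>
  moves the index there and the condition becomes a larger left neighbour.\<close>

lemma Yj_eq:
  assumes "1 \<le> j" "j \<le> k"
  shows "Yj w j = D t j"
proof -
  let ?I = "{i. 1 \<le> i \<and> i < length w \<and> descent w i \<and> occ w (i + 1) = j}"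
  let ?J = "{i. 1 \<le> i \<and> i \<le> length w \<and> occ w i = j \<and> \<not> empty_at t (entry w i) j}"
  have "Suc ` ?I = ?J"
  proof (intro equalityI subsetI)
    fix i assume "i \<in> Suc ` ?I"
    then show "i \<in> ?J" using neighbours(1)[of i] by (auto simp: descent_def)
  next
    fix i assume "i \<in> ?J"
    then have i: "1 \<le> i" "i \<le> length w" "occ w i = j" "entry w i < entry w (i - 1)"
      using neighbours(1)[of i] by auto
    \<comment> \<open>At \<open>i = 1\<close> the left neighbour is the boundary letter 0, which is
      not larger.\<close>
    moreover have "i \<noteq> 1" using i(4) by (intro notI) simp
    ultimately have "i - 1 \<in> ?I" "i = Suc (i - 1)" by (auto simp: descent_def)
    then show "i \<in> Suc ` ?I" by blast
  qed
  then have "card ?J = card (Suc ` ?I)" by (rule arg_cong[OF sym])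
  then have "Yj w j = card ?J" unfolding Yj_def card_image[OF inj_Suc] by (rule sym)
  then show ?thesis using card_letters[OF assms] D_eq[of j] assms by simp
qed

text \<open>Ascents are counted by their right-hand letter, which also covers index 0. A smaller
  left neighbour occurs only at a first copy whose first position is empty.\<close>

lemma X_eq: "X w = L t 1"
proof -
  let ?I = "{i. ascent w i}"
  let ?J = "{i. 1 \<le> i \<and> i \<le> length w \<and> occ w i = 1 \<and> empty_at t (entry w i) 1}"
  have "Suc ` ?I = ?J"
  proof (intro equalityI subsetI)
    fix i assume "i \<in> Suc ` ?I"
    then obtain i' where i': "i = Suc i'" "ascent w i'" by blast
    then have "i' \<noteq> length w" by (intro notI) (simp add: ascent_def)
    then show "i \<in> ?J" using i' neighbours(2)[of i] by (auto simp: ascent_def)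
  next
    fix i assume "i \<in> ?J"
    then have "i - 1 \<in> ?I" "i = Suc (i - 1)"
      using neighbours(2)[of i] by (auto simp: ascent_def)
    then show "i \<in> Suc ` ?I" by blast
  qed
  then have "card ?J = card (Suc ` ?I)" by (rule arg_cong[OF sym])
  then have "X w = card ?J" unfolding X_def card_image[OF inj_Suc] by (rule sym)
  then show ?thesis unfolding L_eq using card_letters[of 1] k by simp
qed

text \<open>Descents are counted by their left-hand letter, which also covers the last index. A
  smaller right neighbour occurs only at a \<open>k\<close>-th copy whose last position is
  empty.\<close>

lemma Y_eq: "Y w = L t (k + 1)"
proof -
  have "{i. descent w i}
      = {i. 1 \<le> i \<and> i \<le> length w \<and> occ w i = k \<and> empty_at t (entry w i) (k + 1)}"
  proof (intro equalityI subsetI)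
    fix i assume i: "i \<in> {i. descent w i}"
    then have "i \<noteq> 0" by (intro notI) (simp add: descent_def)
    then show "i \<in> {i. 1 \<le> i \<and> i \<le> length w \<and> occ w i = k \<and> empty_at t (entry w i) (k + 1)}"
      using i neighbours(5)[of i] by (auto simp: descent_def)
  next
    fix i assume "i \<in> {i. 1 \<le> i \<and> i \<le> length w \<and> occ w i = k \<and> empty_at t (entry w i) (k + 1)}"
    then show "i \<in> {i. descent w i}" using neighbours(5)[of i] by (auto simp: descent_def)
  qed
  then show ?thesis
    unfolding Y_def L_eq using card_letters[of k "\<lambda>v. empty_at t v (k + 1)"] k by simp
qed

lemma Z_eq:
  assumes "n \<ge> 1"
  shows "Z w = (\<Sum>j = 2..k. L t j)"
proof -
  let ?Z = "\<lambda>j. {i. 1 \<le> i \<and> i \<le> length w \<and> plateau w i \<and> occ w i = j}"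
  \<comment> \<open>In the empty word index 0 would be a plateau between the two boundary zeros;
    \<open>n \<ge> 1\<close> rules this out.\<close>
  have "w \<noteq> []" using letter[of 1 1] assms k by fastforce
  then have "entry w 1 \<noteq> 0" using letter_range(1)[of 1] by (cases w) auto
  then have "\<not> plateau w 0" by (simp add: plateau_def)
  then have "1 \<le> i \<and> i \<le> length w \<and> occ w i \<in> {1..<k}" if "plateau w i" for i
    using that neighbours(4)[of i] letter_range[of i] by (cases i) (auto simp: plateau_def)
  then have "{i. plateau w i} = (\<Union>j \<in> {1..<k}. ?Z j)" by blast
  then have "Z w = (\<Sum>j \<in> {1..<k}. Zj w j)"
    unfolding Z_def Zj_def by (simp add: card_UN_disjoint disjoint_iff)
  also have "\<dots> = (\<Sum>j \<in> {1..<k}. L t (Suc j))" using Zj_eq by simp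
  also have "\<dots> = (\<Sum>j \<in> {2..<Suc k}. L t j)"
    using sum.shift_bounds_Suc_ivl[of "L t" 1 k] by (simp add: numeral_2_eq_2)
  finally show ?thesis by (simp add: atLeastLessThanSuc_atLeastAtMost)
qed

section \<open>Blocks\<close>

definition block_value :: "nat \<Rightarrow> bool" where
  "block_value v \<longleftrightarrow> (\<exists>p q. block w p q \<and> entry w p = v)"

text \<open>Two blocks with the same end letter are both contained in the matched substring from the
  smaller left end to the larger right end, so maximality makes them equal. Hence blocks may be
  counted by their letters.\<close>

lemma S_eq: "S w = card {v. block_value v}"
proof -
  have "inj_on (\<lambda>(p, q). entry w p) {(p, q). block w p q}"
  proof (rule inj_onI, clarify)
    fix p q p' q' assume b: "block w p q" "block w p' q'" and e: "entry w p = entry w p'"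
    have m: "matched w (min p p') (max q q')"
      using b e unfolding block_def matched_def by (auto simp: min_def max_def)
    then have "(min p p', max q q') = (p, q)" using b(1) unfolding block_def
      by (metis max.cobounded1 min.cobounded1)
    moreover have "(min p p', max q q') = (p', q')" using m b(2) unfolding block_def
      by (metis max.cobounded2 min.cobounded2)
    ultimately show "p = p' \<and> q = q'" by simp
  qed
  moreover have "{v. block_value v} = (\<lambda>(p, q). entry w p) ` {(p, q). block w p q}"
    unfolding block_value_def by force
  ultimately show ?thesis unfolding S_def by (simp add: card_image)
qed

lemma entry_ex: "x \<in> set Q \<Longrightarrow> \<exists>i. length P < i \<and> i \<le> length P + length Q \<and> entry (P @ Q @ R) i = x"
proof -
  assume "x \<in> set Q"
  then obtain i where "i < length Q" "Q ! i = x" by (auto simp: in_set_conv_nth)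
  then show ?thesis
    by (intro exI[of _ "Suc (length P + i)"]) (simp add: entry_def nth_append)
qed

lemma entry_set: "length P < i \<Longrightarrow> i \<le> length P + length Q \<Longrightarrow> entry (P @ Q @ R) i \<in> set Q"
  by (auto simp: entry_nth nth_append)

text \<open>All copies of \<open>v\<close> lie between \<open>A\<close> and \<open>B\<close>. A
  letter on both sides gives a matched pair strictly enclosing them; conversely, an enclosing
  matched pair must have its ends in \<open>A\<close> and in \<open>B\<close>.\<close>

lemma block_value_embedded:
  assumes "embedded t A (Node v ts) B" "inc k (Node v ts)"
  shows "block_value v \<longleftrightarrow> set A \<inter> set B = {}"
proof -
  let ?s = "Node v ts"
  define M where "M = code ?s"
  have w: "w = A @ M @ B" and disj: "set (A @ B) \<inter> set (labels ?s) = {}"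
    using assms(1) unfolding embedded_def w_def M_def by auto
  have M: "set M \<subseteq> set (labels ?s)" unfolding M_def by (rule set_code)
  have mem: "i \<le> length A \<and> entry w i \<in> set A
      \<or> length A < i \<and> i \<le> length A + length M \<and> entry w i \<in> set M
      \<or> length A + length M < i \<and> entry w i \<in> set B"
    if i: "1 \<le> i" "i \<le> length w" for i
  proof -
    have len: "length w = length A + length M + length B" using w by simp
    consider "i \<le> length A" | "length A < i" "i \<le> length A + length M" | "length A + length M < i"
      by linarith
    then show ?thesis
    proof cases
      case 1
      then show ?thesis using entry_set[of "[]" i A "M @ B"] i w by simp
    next
      case 2
      then show ?thesis using entry_set[of A i M B] w by simp
    next
      case 3
      then show ?thesis using entry_set[of "A @ M" i B "[]"] i len w by simp
    qed
  qed
  have inside: "length A < i \<and> i \<le> length A + length M"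
    if "1 \<le> i" "i \<le> length w" "entry w i = v" for i
    using mem[OF that(1,2)] that(3) disj by auto
  have "set A \<inter> set B = {}" if bv: "block_value v"
  proof -
    from bv obtain p q where b: "block w p q" "entry w p = v" unfolding block_value_def by blast
    then have pq: "1 \<le> p" "p \<le> q" "q \<le> length w" "entry w q = v"
      unfolding block_def matched_def by auto
    show ?thesis
    proof (rule ccontr)
      assume "set A \<inter> set B \<noteq> {}"
      then obtain x where x: "x \<in> set A" "x \<in> set B" by blast
      obtain p' where p': "0 < p'" "p' \<le> length A" "entry w p' = x"
        using entry_ex[OF x(1), of "[]" "M @ B"] w by auto
      obtain q' where q': "length A + length M < q'" "q' \<le> length w" "entry w q' = x"
        using entry_ex[OF x(2), of "A @ M" "[]"] w by auto
      have "matched w p' q'" using p' q' unfolding matched_def by auto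
      moreover have "p' < p" "q < q'"
        using inside[of p] inside[of q] pq b(2) p' q' by auto
      ultimately show False using b(1) unfolding block_def by (metis less_imp_le less_irrefl prod.inject)
    qed
  qed
  moreover have "block_value v" if AB: "set A \<inter> set B = {}"
  proof -
    \<comment> \<open>The first and the last position of \<open>v\<close> are the only candidates
      for the ends of its block.\<close>
    define I where "I = {i. 1 \<le> i \<and> i \<le> length w \<and> entry w i = v}"
    have "v \<in> set (code t)" using root_in_code[OF assms(2) k] w unfolding w_def M_def by simp
    then have vin: "v \<in> {1..n}" using set_code labels_t by blast
    obtain i where "i \<in> I" using letter[OF vin, of 1] k unfolding I_def by auto
    then have I: "finite I" "I \<noteq> {}" unfolding I_def by auto
    define p q where "p = Min I" and "q = Max I"
    have pI: "p \<in> I" and qI: "q \<in> I" unfolding p_def q_def using I by auto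
    have pq: "p \<le> i" "i \<le> q" if "i \<in> I" for i
      unfolding p_def q_def using that I by auto
    have "block w p q" unfolding block_def
    proof
      show "matched w p q" using pI qI pq[OF pI] unfolding I_def matched_def by auto
      show "\<not> (\<exists>p' q'. matched w p' q' \<and> p' \<le> p \<and> q \<le> q' \<and> (p', q') \<noteq> (p, q))"
      proof (intro notI, elim exE conjE)
        fix p' q' assume m: "matched w p' q'" and le: "p' \<le> p" "q \<le> q'" and ne: "(p', q') \<noteq> (p, q)"
        have *: "1 \<le> p'" "p' \<le> length w" "1 \<le> q'" "q' \<le> length w" "entry w p' = entry w q'"
          using m unfolding matched_def by auto
        have nv: "entry w p' \<noteq> v"
        proof
          assume "entry w p' = v"
          then have "p' \<in> I" "q' \<in> I" using * unfolding I_def by auto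
          then show False using pq le ne by (metis le_antisym)
        qed
        have "p' \<noteq> p" "q' \<noteq> q" using nv pI qI * unfolding I_def by auto
        then have lt: "p' < p" "q < q'" "p < q'" using le pq(2)[OF pI] by auto
        \<comment> \<open>The Stirling condition applies because the copy of \<open>v\<close> at
          \<open>p\<close> lies strictly between \<open>p'\<close> and \<open>q'\<close>.\<close>
        then have "entry w p' \<le> entry w p"
          using stirling * unfolding stirling_perm_def by blast
        then have "entry w p' < v" using nv pI unfolding I_def by simp
        \<comment> \<open>Every letter of the code of the subtree is at least \<open>v\<close>, so
          the smaller end letter lies outside it.\<close>
        then have no: "entry w p' \<notin> set M"
          using inc_greater[OF assms(2)] M by fastforce
        have "entry w p' \<in> set A"
          using mem[of p'] no * lt inside[of p] pI unfolding I_def by auto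
        moreover have "entry w p' \<in> set B"
          using mem[of q'] no * lt inside[of q] qI unfolding I_def by auto
        ultimately show False using AB by blast
      qed
    qed
    then show ?thesis unfolding block_value_def using pI unfolding I_def by blast
  qed
  ultimately show ?thesis by blast
qed

text \<open>Passing to the child enlarges the context by \<open>A'\<close> and \<open>B'\<close>.
  Both contain \<open>u\<close> in an inner position, while one of them is empty in an outer
  position.\<close>

lemma block_value_child:
  assumes "child_at t u j v"
  shows "block_value v \<longleftrightarrow> block_value u \<and> (j = 1 \<or> j = k + 1)"
proof -
  have u: "u \<in> {1..n}" using child_at_labels(1)[OF assms] labels_t by simp
  obtain ts A B where ts: "Node u ts \<in> subtrees t" and iu: "inc k (Node u ts)"
    and eu: "embedded t A (Node u ts) B"
    using embedded_vertex[OF u] .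
  obtain us where j: "1 \<le> j" "j \<le> length ts" and v: "ts ! (j - 1) = Node v us"
    using assms subtree_unique[OF inc ts] unfolding child_at_def by blast
  have len: "length ts = k + 1" using inc_length[OF iu] .
  define A' where "A' = pre u (take (j - 1) ts)"
  define B' where "B' = post u (drop j ts)"
  have jl: "j - 1 < length ts" "Suc (j - 1) = j" using j by auto
  have ev: "embedded t (A @ A') (Node v us) (B' @ B)"
    using embedded_child[OF iu eu jl(1)] v jl(2) unfolding A'_def B'_def by simp
  have iv: "inc k (Node v us)" using inc_child[OF iu] jl(1) v by (metis nth_mem)
  have disj: "(set A \<union> set B) \<inter> set (labels (Node u ts)) = {}"
    using eu unfolding embedded_def by simp
  have sub: "set A' \<subseteq> set (labels (Node u ts))" "set B' \<subseteq> set (labels (Node u ts))"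
    unfolding A'_def B'_def
    by (auto dest!: subsetD[OF set_pre] subsetD[OF set_post] in_set_takeD in_set_dropD)
  \<comment> \<open>Letters of \<open>A'\<close> and \<open>B'\<close> are labels of the subtree at
    \<open>u\<close>, hence absent from \<open>A\<close> and \<open>B\<close>; the mixed
    intersections vanish.\<close>
  have "set (A @ A') \<inter> set (B' @ B) = {} \<longleftrightarrow> set A \<inter> set B = {} \<and> set A' \<inter> set B' = {}"
    using disj sub by auto
  moreover have "set A' \<inter> set B' = {} \<longleftrightarrow> j = 1 \<or> j = k + 1"
  proof -
    have "u \<in> set A'" if "j \<noteq> 1"
    proof -
      obtain i where "j - 1 = Suc i" using \<open>j \<noteq> 1\<close> j by (cases "j - 1") auto
      then show ?thesis using pre_Suc[of i ts u] jl unfolding A'_def by simp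
    qed
    moreover have "u \<in> set B'" if "j \<noteq> k + 1"
      using post_Suc[of j ts u] j len that unfolding B'_def by simp
    moreover have "A' = []" if "j = 1" using that unfolding A'_def by (simp add: pre_def)
    moreover have "B' = []" if "j = k + 1" using that len unfolding B'_def by (simp add: post_def)
    ultimately show ?thesis by fastforce
  qed
  ultimately show ?thesis
    using block_value_embedded[OF eu iu] block_value_embedded[OF ev iv] by blast
qed

text \<open>Since parents are unique, the path to \<open>v\<close> is the path to \<open>u\<close>
  followed by \<open>v\<close>. As \<open>v\<close> is not the root, exactly one condition is added,
  and it concerns the position \<open>j\<close>.\<close>

lemma left_right_child:
  assumes "child_at t u j v"
  shows "left_right_node k t v \<longleftrightarrow> left_right_node k t u \<and> (j = 1 \<or> j = k + 1)"
proof -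
  have uv: "u < v" using assms inc unfolding inc_def by blast
  have u: "u \<in> vertices t" and v: "v \<in> vertices t"
    using child_at_labels[OF assms] unfolding vertices_def by auto
  have anc: "(x, v) \<in> (edges t)\<^sup>* \<longleftrightarrow> x = v \<or> (x, u) \<in> (edges t)\<^sup>*" for x
  proof
    assume "(x, v) \<in> (edges t)\<^sup>*"
    then show "x = v \<or> (x, u) \<in> (edges t)\<^sup>*"
    proof (cases rule: rtranclE)
      case (step y)
      then show ?thesis using parent_unique[OF inc assms] unfolding edges_def by blast
    qed simp
  next
    assume "x = v \<or> (x, u) \<in> (edges t)\<^sup>*"
    then show "(x, v) \<in> (edges t)\<^sup>*" using assms unfolding edges_def
      by (auto intro: rtrancl_into_rtrancl)
  qed
  define P where "P x \<longleftrightarrow> (\<exists>u'. child_at t u' 1 x \<or> child_at t u' (k + 1) x)" for x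
  have P: "P v \<longleftrightarrow> j = 1 \<or> j = k + 1"
    unfolding P_def using assms parent_unique[OF inc assms] by blast
  have "v \<noteq> 1" using uv u labels_t unfolding vertices_def by auto
  then show ?thesis
    unfolding left_right_node_def P_def[symmetric] anc P[symmetric] using u v by blast
qed

text \<open>Both properties obey the same recursion from parent to child, so induction on the label
  works, parents being smaller. At the root the context is empty on both sides and no edge
  enters.\<close>

lemma block_value_iff_left_right:
  assumes "v \<in> {1..n}"
  shows "block_value v \<longleftrightarrow> left_right_node k t v"
  using assms
proof (induction v rule: less_induct)
  case (less v)
  obtain ts where ts: "t = Node 1 ts" using t unfolding increasing_tree_def by blast
  show ?case
  proof (cases "v = 1")
    case True
    have no: "\<not> child_at t u j 1" for u j
      using root_no_parent inc ts by metis
    have "embedded t [] (Node 1 ts) []" using labels_t ts unfolding embedded_def by auto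
    then have "block_value 1" using block_value_embedded inc ts by force
    moreover have "x = 1" if "(x, 1) \<in> (edges t)\<^sup>*" for x
      using that by (cases rule: rtranclE) (auto simp: edges_def no[simplified])
    then have "left_right_node k t 1"
      using less.prems True labels_t unfolding left_right_node_def vertices_def by auto
    ultimately show ?thesis using True by simp
  next
    case False
    then have "\<forall>us. t \<noteq> Node v us" using ts by simp
    then obtain u j where c: "child_at t u j v"
      using parent_exists less.prems labels_t by blast
    moreover have "u < v" "u \<in> {1..n}"
      using c inc child_at_labels(1) labels_t unfolding inc_def by blast+
    ultimately show ?thesis
      using less.IH block_value_child left_right_child by blast
  qed
qed

lemma S_eq_LR: "S w = LR k t"
proof -
  have "v \<in> {1..n}" if "block_value v" for v
    using that letter_range(1) unfolding block_value_def block_def matched_def by force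
  moreover have "v \<in> {1..n}" if "left_right_node k t v" for v
    using that labels_t unfolding left_right_node_def vertices_def by simp
  ultimately have "{v. block_value v} = {v. left_right_node k t v}"
    using block_value_iff_left_right by blast
  then show ?thesis unfolding S_eq LR_def by simp
qed

end

theorem theorem3p4:
  fixes k n :: nat and \<tau> :: ptree and \<sigma> :: "nat list"
  assumes "k \<ge> 1" and "n \<ge> 1"
    and "increasing_tree k n \<tau>"
    and "\<sigma> = code \<tau>"
  shows "(\<forall>j\<in>{1..k}. Xj \<sigma> j = D \<tau> (j + 1))
    \<and> (\<forall>j\<in>{1..k}. Yj \<sigma> j = D \<tau> j)
    \<and> (\<forall>j\<in>{1..k - 1}. Zj \<sigma> j = L \<tau> (j + 1)
          \<and> int (L \<tau> (j + 1)) = int n - int (D \<tau> (j + 1)))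
    \<and> int (X \<sigma>) = int n - int (D \<tau> 1) \<and> int n - int (D \<tau> 1) = int (L \<tau> 1)
    \<and> int (Y \<sigma>) = int n - int (D \<tau> (k + 1)) \<and> int n - int (D \<tau> (k + 1)) = int (L \<tau> (k + 1))
    \<and> Z \<sigma> = (\<Sum>j = 2..k. L \<tau> j)
    \<and> S \<sigma> = LR k \<tau>"
proof -
  interpret increasing k n \<tau> "code \<tau>"
    using assms by unfold_locales
  have L: "int (L \<tau> j) = int n - int (D \<tau> j)" if "1 \<le> j" "j \<le> k + 1" for j
    using D_plus_L[OF that] by linarith
  show ?thesis
    unfolding assms(4) using Xj_eq Yj_eq Zj_eq L[of 1] L[of "k + 1"] L X_eq Y_eq Z_eq S_eq_LR assms
    by auto
qed

end
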